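(* Let $X$ be a set, $E$ a set of parameters, and let $(X,\Sigma,E)$ be a soft topological space. Let $\boldsymbol{\Sigma}=\{\Sigma_e : e\in E\}$ be the family of all crisp topologies from $\Sigma$, where $\Sigma_e=\{F(e) : (F,E)\in\Sigma\}$. Then $\Sigma\subseteq\mathcal{T}(\boldsymbol{\Sigma})$, i.e. every soft open set of $\Sigma$ belongs to the soft topology $\mathcal{T}(\boldsymbol{\Sigma})$.
   Context: A soft set over $X$ (with parameter set $E$) is $(F,E)=\{(e,F(e)) : e\in E\}$ where $F:E\to\mathcal{P}(X)$ is a map; $S_E(X)$ is the family of all soft sets. Unions and intersections of soft sets are taken parameterwise. The null soft set $\widetilde{\Phi}$ has $F(e)=\emptyset$ for all $e$; the absolute soft set $\widetilde{X}$ has $F(e)=X$ for all $e$. A soft topology on $X$ is a collection $\Sigma\subseteq S_E(X)$ containing $\widetilde{\Phi}$ and $\widetilde{X}$, closed under pairwise (parameterwise) intersections and arbitrary (parameterwise) unions; $(X,\Sigma,E)$ is then called a soft topological space. For a soft topology $\Sigma$ and $e\in E$, $\Sigma_e=\{F(e) : (F,E)\in\Sigma\}$ is an ordinary ("crisp") topology on $X$. For a family $\boldsymbol{\Sigma}=\{\Sigma_e : e\in E\}$ of crisp topologies on $X$ indexed by $E$, the soft topology generated by $\boldsymbol{\Sigma}$ is $\mathcal{T}(\boldsymbol{\Sigma})=\{(F,E)\in S_E(X) : F(e)\in\Sigma_e \text{ for all } e\in E\}$. *)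

theory Defs
  imports "HOL-Analysis.Abstract_Topology" "HOL-Library.FuncSet"
begin

text \<open>
  A soft set over \<open>X\<close> with parameter set \<open>E\<close> is the graph of a map from \<open>E\<close> to the power set
  of \<open>X\<close>.  It is represented by the extensional function on \<open>E\<close> (with value \<open>undefined\<close> outside
  \<open>E\<close>), so that equality of soft sets is equality of these graphs.
\<close>

type_synonym ('e, 'a) soft_set = "'e \<Rightarrow> 'a set"

definition soft_sets :: "'e set \<Rightarrow> 'a set \<Rightarrow> ('e, 'a) soft_set set" where
  "soft_sets E X = (E \<rightarrow>\<^sub>E Pow X)"

definition null_soft_set :: "'e set \<Rightarrow> ('e, 'a) soft_set" where
  "null_soft_set E = (\<lambda>e\<in>E. {})"

definition absolute_soft_set :: "'e set \<Rightarrow> 'a set \<Rightarrow> ('e, 'a) soft_set" where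
  "absolute_soft_set E X = (\<lambda>e\<in>E. X)"

definition soft_inter ::
    "'e set \<Rightarrow> ('e, 'a) soft_set \<Rightarrow> ('e, 'a) soft_set \<Rightarrow> ('e, 'a) soft_set" where
  "soft_inter E F G = (\<lambda>e\<in>E. F e \<inter> G e)"

definition soft_Union :: "'e set \<Rightarrow> ('e, 'a) soft_set set \<Rightarrow> ('e, 'a) soft_set" where
  "soft_Union E \<F> = (\<lambda>e\<in>E. \<Union>F\<in>\<F>. F e)"

definition soft_topology :: "'e set \<Rightarrow> 'a set \<Rightarrow> ('e, 'a) soft_set set \<Rightarrow> bool" where
  "soft_topology E X \<Sigma> \<longleftrightarrow>
     \<Sigma> \<subseteq> soft_sets E X \<and>
     null_soft_set E \<in> \<Sigma> \<and>
     absolute_soft_set E X \<in> \<Sigma> \<and>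
     (\<forall>F\<in>\<Sigma>. \<forall>G\<in>\<Sigma>. soft_inter E F G \<in> \<Sigma>) \<and>
     (\<forall>\<F>. \<F> \<subseteq> \<Sigma> \<longrightarrow> soft_Union E \<F> \<in> \<Sigma>)"

text \<open>
  The abstraction \<open>topology\<close> is meaningful only if its argument satisfies \<open>istopology\<close>; for a soft
  topology and a parameter in \<open>E\<close> this is \<open>istopology_crisp\<close> below.
\<close>

definition crisp_topology :: "('e, 'a) soft_set set \<Rightarrow> 'e \<Rightarrow> 'a topology" where
  "crisp_topology \<Sigma> e = topology (\<lambda>U. U \<in> {F e | F. F \<in> \<Sigma>})"

definition generated_soft_topology ::
    "'e set \<Rightarrow> 'a set \<Rightarrow> ('e \<Rightarrow> 'a topology) \<Rightarrow> ('e, 'a) soft_set set" where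
  "generated_soft_topology E X T = {F \<in> soft_sets E X. \<forall>e\<in>E. openin (T e) (F e)}"

lemma istopology_crisp:
  assumes \<Sigma>: "soft_topology E X \<Sigma>" and e: "e \<in> E"
  shows "istopology (\<lambda>U. U \<in> {F e | F. F \<in> \<Sigma>})"
proof -
  have "S \<inter> T \<in> (\<lambda>F. F e) ` \<Sigma>" if ST: "S \<in> (\<lambda>F. F e) ` \<Sigma>" "T \<in> (\<lambda>F. F e) ` \<Sigma>" for S T
  proof -
    obtain F G where FG: "F \<in> \<Sigma>" "G \<in> \<Sigma>" "S = F e" "T = G e"
      using ST by (elim imageE)
    show ?thesis
    proof (rule image_eqI)
      show "S \<inter> T = soft_inter E F G e"
        using e FG(3,4) by (simp add: soft_inter_def)
      show "soft_inter E F G \<in> \<Sigma>"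
        using \<Sigma> FG(1,2) by (simp add: soft_topology_def)
    qed
  qed
  moreover have "\<Union>\<K> \<in> (\<lambda>F. F e) ` \<Sigma>" if K: "\<K> \<subseteq> (\<lambda>F. F e) ` \<Sigma>" for \<K>
  proof -
    obtain \<F> where \<F>: "\<F> \<subseteq> \<Sigma>" "\<K> = (\<lambda>F. F e) ` \<F>"
      using K by (rule subset_imageE)
    show ?thesis
    proof (rule image_eqI)
      show "\<Union>\<K> = soft_Union E \<F> e"
        using e \<F>(2) by (simp add: soft_Union_def)
      show "soft_Union E \<F> \<in> \<Sigma>"
        using \<Sigma> \<F>(1) by (simp add: soft_topology_def)
    qed
  qed
  ultimately show ?thesis
    unfolding istopology_def Setcompr_eq_image Collect_mem_eq subset_iff by simp
qed

lemma openin_crisp_topology: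
  assumes "soft_topology E X \<Sigma>" "e \<in> E"
  shows "openin (crisp_topology \<Sigma> e) U \<longleftrightarrow> U \<in> {F e | F. F \<in> \<Sigma>}"
  using topology_inverse'[OF istopology_crisp[OF assms]]
  by (simp add: crisp_topology_def)

lemma topspace_crisp_topology:
  assumes \<Sigma>: "soft_topology E X \<Sigma>" and e: "e \<in> E"
  shows "topspace (crisp_topology \<Sigma> e) = X"
proof
  have "F e \<subseteq> X" if "F \<in> \<Sigma>" for F
  proof -
    have "F \<in> E \<rightarrow>\<^sub>E Pow X"
      using \<Sigma> that by (simp add: soft_topology_def soft_sets_def subset_iff)
    from PiE_mem[OF this e] show ?thesis by simp
  qed
  then show "topspace (crisp_topology \<Sigma> e) \<subseteq> X"
    by (auto simp: topspace_def openin_crisp_topology[OF \<Sigma> e] Setcompr_eq_image)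
  have "absolute_soft_set E X \<in> \<Sigma>"
    using \<Sigma> by (simp add: soft_topology_def)
  then have "openin (crisp_topology \<Sigma> e) (absolute_soft_set E X e)"
    unfolding openin_crisp_topology[OF \<Sigma> e] Setcompr_eq_image Collect_mem_eq by (rule imageI)
  from openin_subset[OF this] show "X \<subseteq> topspace (crisp_topology \<Sigma> e)"
    using e by (simp add: absolute_soft_set_def)
qed

lemma soft_topology_generated:
  assumes T: "\<And>e. e \<in> E \<Longrightarrow> topspace (T e) = X"
  shows "soft_topology E X (generated_soft_topology E X T)"
proof -
  have gen: "(\<lambda>e\<in>E. H e) \<in> generated_soft_topology E X T \<longleftrightarrow> (\<forall>e\<in>E. openin (T e) (H e))"
    for H
  proof -
    have "H e \<subseteq> X" if "e \<in> E" "openin (T e) (H e)" for e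
      using T[OF that(1)] openin_subset[OF that(2)] by simp
    then show ?thesis
      by (simp add: generated_soft_topology_def soft_sets_def PiE_iff) blast
  qed
  have X: "openin (T e) X" if "e \<in> E" for e
    using T[OF that] openin_topspace[of "T e"] by simp
  have open': "openin (T e) (F e)" if "F \<in> generated_soft_topology E X T" "e \<in> E" for F e
    using that by (simp add: generated_soft_topology_def)
  show ?thesis
    unfolding soft_topology_def null_soft_set_def absolute_soft_set_def soft_inter_def
      soft_Union_def gen
  proof (intro conjI ballI allI impI)
    show "generated_soft_topology E X T \<subseteq> soft_sets E X"
      by (simp add: generated_soft_topology_def)
  next
    fix \<F> e
    assume "\<F> \<subseteq> generated_soft_topology E X T" "e \<in> E"
    then show "openin (T e) (\<Union>F\<in>\<F>. F e)"
      by (intro openin_Union) (auto simp: generated_soft_topology_def)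
  qed (simp_all add: X open' openin_Int)
qed

end

theory Submission
  imports Defs
begin

text \<open>A value \<open>F e\<close> of a soft open set is, by construction, one of the sets that
  make up the crisp topology at \<open>e\<close>. The real content is that these sets do form a
  topology, so that \<open>openin\<close> recovers exactly them; this is
  \<open>openin_crisp_topology\<close>, obtained by evaluating the soft axioms at
  \<open>e\<close>.\<close>

theorem lemma3p3:
  fixes X :: "'a set" and E :: "'e set" and \<Sigma> :: "('e, 'a) soft_set set"
  assumes "soft_topology E X \<Sigma>"
  shows "\<Sigma> \<subseteq> generated_soft_topology E X (crisp_topology \<Sigma>)"
proof
  fix F
  assume F: "F \<in> \<Sigma>"
  then have "F \<in> soft_sets E X"
    using assms by (auto simp: soft_topology_def)
  \<comment> \<open>The soft set \<open>F\<close> itself is the witness that \<open>F e\<close> is a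
    slice at \<open>e\<close>.\<close>
  moreover have "openin (crisp_topology \<Sigma> e) (F e)" if "e \<in> E" for e
    using F by (auto simp: openin_crisp_topology[OF assms that])
  ultimately show "F \<in> generated_soft_topology E X (crisp_topology \<Sigma>)"
    by (simp add: generated_soft_topology_def)
qed

end
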